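(* Let $(\phi^n)_{n=0}^{N}$ be a sequence in which each $\phi^{n+1}$ ($0\le n\le N-1$) is obtained from $\phi^n$ by one time step of the two-dimensional dimensional-splitting upwind-SAV scheme described in the context. Then the total mass is conserved: for every $0\le n\le N-1$, $$\sum_{i=1}^{N_x}\sum_{j=1}^{N_y}\phi_{i,j}^{n+1}=\sum_{i=1}^{N_x}\sum_{j=1}^{N_y}\phi_{i,j}^{n}=\cdots=\sum_{i=1}^{N_x}\sum_{j=1}^{N_y}\phi_{i,j}^{0}.$$
   Context: Parameters: integers $N_x,N_y\ge2$, cell sizes $\Delta x,\Delta y>0$, time step $\Delta t>0$, interface parameter $\varepsilon>0$, a positive integer $k$. The potential $F:I\to\mathbb{R}$ is the free energy density, differentiable on its domain of definition $I\subseteq\mathbb{R}$, an interval; typical choices are the logarithmic Flory--Huggins potential $F(\phi)=\frac{\theta}{2}[(1+\phi)\ln(1+\phi)+(1-\phi)\ln(1-\phi)]+\frac{\theta_c}{2}(1-\phi^2)$ with $0<\theta<\theta_c$ (differentiable on $I=(-1,1)$), or the polynomial potential $F(\phi)=\frac14(1-\phi^2)^2$ (with $I=\mathbb{R}$). All arrays of cell averages below take values in $I$. Notation: $\chi^+=\max\{\chi,0\}$, $\chi^-=\min\{\chi,0\}$, and $M(\chi_1,\chi_2)=\big[(1+\chi_1)^+(1-\chi_2)^+\big]^k$. For an array $\psi=(\psi_{i,j})_{1\le i\le N_x,1\le j\le N_y}$ the discrete Laplacian with Neumann boundary conditions is $$(\Delta\psi)_{i,j}=\frac{\psi_{i+1,j}-2\psi_{i,j}+\psi_{i-1,j}}{\Delta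 x^2}+\frac{\psi_{i,j+1}-2\psi_{i,j}+\psi_{i,j-1}}{\Delta y^2},$$ with the convention $\psi_{0,j}:=\psi_{1,j}$, $\psi_{N_x+1,j}:=\psi_{N_x,j}$, $\psi_{i,0}:=\psi_{i,1}$, $\psi_{i,N_y+1}:=\psi_{i,N_y}$. Scheme (one time step from $\phi^n$ to $\phi^{n+1}$): Step 1 ($x$-direction). Set $\widetilde\phi^{n,0}=\phi^n$. For $q=1,\dots,N_y$ successively, the array $\widetilde\phi^{n,q}$ and the scalar $\widetilde\xi^{n,q}\in\mathbb{R}$ satisfy $$\widetilde\phi_{i,j}^{n,q}-\widetilde\phi_{i,j}^{n,q-1}=\begin{cases}-\frac{\Delta t}{\Delta x}\left(\widetilde J_{i+\frac12,j}^{n,q}-\widetilde J_{i-\frac12,j}^{n,q}\right),& j=q,\\ 0,& j\ne q,\end{cases}$$ $$\widetilde J_{i+\frac12,j}^{n,q}=\left(\widetilde V_{i+\frac12,j}^{n,q}\right)^+M(\widetilde\phi_{i,j}^{n,q},\widetilde\phi_{i+1,j}^{n,q})+\left(\widetilde V_{i+\frac12,j}^{n,q}\right)^-M(\widetilde\phi_{i+1,j}^{n,q},\widetilde\phi_{i,j}^{n,q}),\quad 1\le i\le N_x-1,$$ $$\widetilde V_{i+\frac12,j}^{n,q}=-\frac1{\Delta x}\left(\widetilde\mu_{i+1,j}^{n,q}-\widetilde\mu_{i,j}^{n,q}\right),\qquad \widetilde\mu_{i,j}^{n,q}=-\varepsilon^2(\Delta\widetilde\phi^{n,q})_{i,j}+\widetilde\xi^{n,q}F'(\widetilde\phi_{i,j}^{n,q}),$$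 $$\sum_{i=1}^{N_x}\sum_{j=1}^{N_y}\left(F(\widetilde\phi_{i,j}^{n,q})-F(\widetilde\phi_{i,j}^{n,q-1})\right)=\widetilde\xi^{n,q}\sum_{i=1}^{N_x}\sum_{j=1}^{N_y}F'(\widetilde\phi_{i,j}^{n,q})(\widetilde\phi_{i,j}^{n,q}-\widetilde\phi_{i,j}^{n,q-1}),$$ with no-flux conditions $\widetilde J_{\frac12,j}^{n,q}=\widetilde J_{N_x+\frac12,j}^{n,q}=0$ for all $j$. Step 2 ($y$-direction). Set $\widehat\phi^{n,0}=\widetilde\phi^{n,N_y}$. For $p=1,\dots,N_x$ successively, the array $\widehat\phi^{n,p}$ and the scalar $\widehat\xi^{n,p}\in\mathbb{R}$ satisfy $$\widehat\phi_{i,j}^{n,p}-\widehat\phi_{i,j}^{n,p-1}=\begin{cases}-\frac{\Delta t}{\Delta y}\left(\widehat J_{i,j+\frac12}^{n,p}-\widehat J_{i,j-\frac12}^{n,p}\right),& i=p,\\ 0,& i\ne p,\end{cases}$$ $$\widehat J_{i,j+\frac12}^{n,p}=\left(\widehat V_{i,j+\frac12}^{n,p}\right)^+M(\widehat\phi_{i,j}^{n,p},\widehat\phi_{i,j+1}^{n,p})+\left(\widehat V_{i,j+\frac12}^{n,p}\right)^-M(\widehat\phi_{i,j+1}^{n,p},\widehat\phi_{i,j}^{n,p}),\quad 1\le j\le N_y-1,$$ $$\widehat V_{i,j+\frac12}^{n,p}=-\frac1{\Delta y}\left(\widehat\mu_{i,j+1}^{n,p}-\widehat\mu_{i,j}^{n,p}\right),\qquad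 \widehat\mu_{i,j}^{n,p}=-\varepsilon^2(\Delta\widehat\phi^{n,p})_{i,j}+\widehat\xi^{n,p}F'(\widehat\phi_{i,j}^{n,p}),$$ $$\sum_{i=1}^{N_x}\sum_{j=1}^{N_y}\left(F(\widehat\phi_{i,j}^{n,p})-F(\widehat\phi_{i,j}^{n,p-1})\right)=\widehat\xi^{n,p}\sum_{i=1}^{N_x}\sum_{j=1}^{N_y}F'(\widehat\phi_{i,j}^{n,p})(\widehat\phi_{i,j}^{n,p}-\widehat\phi_{i,j}^{n,p-1}),$$ with no-flux conditions $\widehat J_{i,\frac12}^{n,p}=\widehat J_{i,N_y+\frac12}^{n,p}=0$ for all $i$. Finally $\phi^{n+1}=\widehat\phi^{n,N_x}$ and $\xi^{n+1}=\frac{1}{N_x+N_y}\left(\sum_{q=1}^{N_y}\widetilde\xi^{n,q}+\sum_{p=1}^{N_x}\widehat\xi^{n,p}\right)$. *)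

theory Defs
  imports "HOL-Analysis.Analysis"
begin

text \<open>
  A grid function is a total function on pairs of naturals; only its values at the indices
  \<open>1 \<le> i \<le> Nx\<close>, \<open>1 \<le> j \<le> Ny\<close> are meaningful, and nothing below depends on the others.
  \<open>F\<close> is the potential on the interval \<open>I\<close> and \<open>F'\<close> its derivative there; that \<open>F'\<close> is the derivative
  of \<open>F\<close>, and the constraints on the other parameters, are assumptions of the theorem rather
  than of the locale.
\<close>

type_synonym grid_fun = "nat \<Rightarrow> nat \<Rightarrow> real"

definition mobility :: "nat \<Rightarrow> real \<Rightarrow> real \<Rightarrow> real" where
  "mobility k a b = (max (1 + a) 0 * max (1 - b) 0) ^ k"

locale upwind_sav =
  fixes Nx Ny :: nat
    and \<Delta>x \<Delta>y \<Delta>t \<epsilon> :: real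
    and k :: nat
    and I :: "real set"
    and F F' :: "real \<Rightarrow> real"
begin

definition grid_eq :: "grid_fun \<Rightarrow> grid_fun \<Rightarrow> bool" where
  "grid_eq \<psi> \<eta> \<longleftrightarrow> (\<forall>i\<in>{1..Nx}. \<forall>j\<in>{1..Ny}. \<psi> i j = \<eta> i j)"

definition grid_in :: "grid_fun \<Rightarrow> bool" where
  "grid_in \<psi> \<longleftrightarrow> (\<forall>i\<in>{1..Nx}. \<forall>j\<in>{1..Ny}. \<psi> i j \<in> I)"

text \<open>
  Neumann ghost cells: clamping the indices makes the value at index \<open>0\<close> that at index \<open>1\<close>,
  and the value at index \<open>Nx + 1\<close> (resp. \<open>Ny + 1\<close>) that at index \<open>Nx\<close> (resp. \<open>Ny\<close>).
\<close>

definition neumann_ext :: "grid_fun \<Rightarrow> grid_fun" where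
  "neumann_ext \<psi> i j = \<psi> (max 1 (min i Nx)) (max 1 (min j Ny))"

definition laplacian :: "grid_fun \<Rightarrow> grid_fun" where
  "laplacian \<psi> i j =
     (neumann_ext \<psi> (i + 1) j - 2 * neumann_ext \<psi> i j + neumann_ext \<psi> (i - 1) j) / \<Delta>x\<^sup>2 +
     (neumann_ext \<psi> i (j + 1) - 2 * neumann_ext \<psi> i j + neumann_ext \<psi> i (j - 1)) / \<Delta>y\<^sup>2"

definition chem_pot :: "grid_fun \<Rightarrow> real \<Rightarrow> grid_fun" where
  "chem_pot \<psi> \<xi> i j = - (\<epsilon>\<^sup>2 * laplacian \<psi> i j) + \<xi> * F' (\<psi> i j)"

text \<open>
  Edge quantities: the index \<open>i\<close> of \<open>velocity_x\<close> and \<open>flux_x\<close> stands for the edge \<open>i + 1/2\<close>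
  between the cells \<open>i\<close> and \<open>i + 1\<close>, and likewise for \<open>j\<close> in the \<open>y\<close>-direction. The boundary
  edges \<open>0\<close> and \<open>Nx\<close> (resp. \<open>Ny\<close>) carry no flux.
\<close>

definition velocity_x :: "grid_fun \<Rightarrow> real \<Rightarrow> grid_fun" where
  "velocity_x \<psi> \<xi> i j = - (1 / \<Delta>x) * (chem_pot \<psi> \<xi> (i + 1) j - chem_pot \<psi> \<xi> i j)"

definition velocity_y :: "grid_fun \<Rightarrow> real \<Rightarrow> grid_fun" where
  "velocity_y \<psi> \<xi> i j = - (1 / \<Delta>y) * (chem_pot \<psi> \<xi> i (j + 1) - chem_pot \<psi> \<xi> i j)"

definition flux_x :: "grid_fun \<Rightarrow> real \<Rightarrow> grid_fun" where
  "flux_x \<psi> \<xi> i j =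
     (if 1 \<le> i \<and> i \<le> Nx - 1
      then max (velocity_x \<psi> \<xi> i j) 0 * mobility k (\<psi> i j) (\<psi> (i + 1) j) +
           min (velocity_x \<psi> \<xi> i j) 0 * mobility k (\<psi> (i + 1) j) (\<psi> i j)
      else 0)"

definition flux_y :: "grid_fun \<Rightarrow> real \<Rightarrow> grid_fun" where
  "flux_y \<psi> \<xi> i j =
     (if 1 \<le> j \<and> j \<le> Ny - 1
      then max (velocity_y \<psi> \<xi> i j) 0 * mobility k (\<psi> i j) (\<psi> i (j + 1)) +
           min (velocity_y \<psi> \<xi> i j) 0 * mobility k (\<psi> i (j + 1)) (\<psi> i j)
      else 0)"

definition sav_relation :: "grid_fun \<Rightarrow> grid_fun \<Rightarrow> real \<Rightarrow> bool" where
  "sav_relation \<psi>0 \<psi> \<xi> \<longleftrightarrow>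
     (\<Sum>i=1..Nx. \<Sum>j=1..Ny. F (\<psi> i j) - F (\<psi>0 i j)) =
     \<xi> * (\<Sum>i=1..Nx. \<Sum>j=1..Ny. F' (\<psi> i j) * (\<psi> i j - \<psi>0 i j))"

text \<open>
  The substeps are implicit: \<open>\<psi>0\<close> is the old array, and the fluxes are evaluated at the new pair
  \<open>(\<psi>, \<xi>)\<close>.
\<close>

definition substep_x :: "nat \<Rightarrow> grid_fun \<Rightarrow> grid_fun \<Rightarrow> real \<Rightarrow> bool" where
  "substep_x q \<psi>0 \<psi> \<xi> \<longleftrightarrow>
     (\<forall>i\<in>{1..Nx}. \<forall>j\<in>{1..Ny}.
        \<psi> i j - \<psi>0 i j =
          (if j = q then - (\<Delta>t / \<Delta>x) * (flux_x \<psi> \<xi> i j - flux_x \<psi> \<xi> (i - 1) j) else 0)) \<and>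
     sav_relation \<psi>0 \<psi> \<xi>"

definition substep_y :: "nat \<Rightarrow> grid_fun \<Rightarrow> grid_fun \<Rightarrow> real \<Rightarrow> bool" where
  "substep_y p \<psi>0 \<psi> \<xi> \<longleftrightarrow>
     (\<forall>i\<in>{1..Nx}. \<forall>j\<in>{1..Ny}.
        \<psi> i j - \<psi>0 i j =
          (if i = p then - (\<Delta>t / \<Delta>y) * (flux_y \<psi> \<xi> i j - flux_y \<psi> \<xi> i (j - 1)) else 0)) \<and>
     sav_relation \<psi>0 \<psi> \<xi>"

definition time_step :: "grid_fun \<Rightarrow> grid_fun \<Rightarrow> real \<Rightarrow> bool" where
  "time_step \<phi> \<phi>' \<xi>' \<longleftrightarrow>
     (\<exists>(\<phi>x :: nat \<Rightarrow> grid_fun) (\<xi>x :: nat \<Rightarrow> real) (\<phi>y :: nat \<Rightarrow> grid_fun) (\<xi>y :: nat \<Rightarrow> real).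
        (\<forall>q\<le>Ny. grid_in (\<phi>x q)) \<and> (\<forall>p\<le>Nx. grid_in (\<phi>y p)) \<and>
        grid_eq (\<phi>x 0) \<phi> \<and>
        (\<forall>q\<in>{1..Ny}. substep_x q (\<phi>x (q - 1)) (\<phi>x q) (\<xi>x q)) \<and>
        grid_eq (\<phi>y 0) (\<phi>x Ny) \<and>
        (\<forall>p\<in>{1..Nx}. substep_y p (\<phi>y (p - 1)) (\<phi>y p) (\<xi>y p)) \<and>
        grid_eq \<phi>' (\<phi>y Nx) \<and>
        \<xi>' = 1 / real (Nx + Ny) * ((\<Sum>q=1..Ny. \<xi>x q) + (\<Sum>p=1..Nx. \<xi>y p)))"

end

end

theory Submission
  imports Defs
begin

text \<open>
  A substep adds to one grid line a multiple of a discrete divergence. Summed over that line the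
  fluxes telescope, and the two boundary fluxes vanish, so no mass is gained or lost.
\<close>

context upwind_sav
begin

definition mass :: "grid_fun \<Rightarrow> real" where
  "mass \<psi> = (\<Sum>i=1..Nx. \<Sum>j=1..Ny. \<psi> i j)"

text \<open>\<open>time_step\<close> links its sweeps by \<open>grid_eq\<close> only, since values
  off the grid are arbitrary. Mass sees grid cells alone, so it passes across these links.\<close>

lemma mass_cong: "grid_eq \<psi> \<eta> \<Longrightarrow> mass \<psi> = mass \<eta>"
  unfolding mass_def grid_eq_def by (intro sum.cong refl) auto

lemma mass_diff: "mass \<psi> - mass \<eta> = (\<Sum>i=1..Nx. \<Sum>j=1..Ny. \<psi> i j - \<eta> i j)"
  by (simp add: mass_def sum_subtractf)

lemma sum_flux_x: "(\<Sum>i=1..Nx. flux_x \<psi> \<xi> i j - flux_x \<psi> \<xi> (i - 1) j) = 0"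
proof -
  have "(\<Sum>i=1..Nx. flux_x \<psi> \<xi> i j - flux_x \<psi> \<xi> (i - 1) j) = flux_x \<psi> \<xi> Nx j - flux_x \<psi> \<xi> 0 j"
    using sum_telescope''[of 0 Nx "\<lambda>i. flux_x \<psi> \<xi> i j"]
    by (simp flip: atLeastSucAtMost_greaterThanAtMost)
  \<comment> \<open>Edge \<open>0\<close> fails \<open>1 \<le> i\<close> and edge \<open>Nx\<close>
    fails \<open>i \<le> Nx - 1\<close>, so both fall into the zero branch. This includes
    \<open>Nx = 0\<close>, where \<open>Nx - 1\<close> truncates to \<open>0\<close>.\<close>
  then show ?thesis by (auto simp: flux_x_def)
qed

lemma sum_flux_y: "(\<Sum>j=1..Ny. flux_y \<psi> \<xi> i j - flux_y \<psi> \<xi> i (j - 1)) = 0"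
proof -
  have "(\<Sum>j=1..Ny. flux_y \<psi> \<xi> i j - flux_y \<psi> \<xi> i (j - 1)) = flux_y \<psi> \<xi> i Ny - flux_y \<psi> \<xi> i 0"
    using sum_telescope''[of 0 Ny "\<lambda>j. flux_y \<psi> \<xi> i j"]
    by (simp flip: atLeastSucAtMost_greaterThanAtMost)
  then show ?thesis by (auto simp: flux_y_def)
qed

text \<open>Telescoping works for any interior edge values, so evaluating the fluxes implicitly at
  the new pair (\<psi>, \<xi>) causes no difficulty.\<close>

lemma substep_x_mass:
  assumes "substep_x q \<psi>0 \<psi> \<xi>"
  shows "mass \<psi> = mass \<psi>0"
proof -
  have "mass \<psi> - mass \<psi>0 = (\<Sum>i=1..Nx. \<Sum>j=1..Ny.
      if j = q then - (\<Delta>t / \<Delta>x) * (flux_x \<psi> \<xi> i j - flux_x \<psi> \<xi> (i - 1) j) else 0)"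
    unfolding mass_diff using assms
    by (intro sum.cong refl) (auto simp: substep_x_def)
  \<comment> \<open>The test \<open>j = q\<close> is constant in \<open>i\<close>. Swapping the sums
    makes \<open>i\<close> the inner index, so the factor comes out and a telescoping sum
    remains.\<close>
  also have "\<dots> = (\<Sum>j=1..Ny. if j = q
      then - (\<Delta>t / \<Delta>x) * (\<Sum>i=1..Nx. flux_x \<psi> \<xi> i j - flux_x \<psi> \<xi> (i - 1) j) else 0)"
    by (subst sum.swap) (intro sum.cong refl, auto simp: sum_distrib_left)
  finally show ?thesis unfolding sum_flux_x by (simp split: if_splits)
qed

lemma substep_y_mass:
  assumes "substep_y p \<psi>0 \<psi> \<xi>"
  shows "mass \<psi> = mass \<psi>0"
proof -
  have "mass \<psi> - mass \<psi>0 = (\<Sum>i=1..Nx. \<Sum>j=1..Ny.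
      if i = p then - (\<Delta>t / \<Delta>y) * (flux_y \<psi> \<xi> i j - flux_y \<psi> \<xi> i (j - 1)) else 0)"
    unfolding mass_diff using assms
    by (intro sum.cong refl) (auto simp: substep_y_def)
  \<comment> \<open>Here the outer index already selects the updated line, so the sums stay in
    order.\<close>
  also have "\<dots> = (\<Sum>i=1..Nx. if i = p
      then - (\<Delta>t / \<Delta>y) * (\<Sum>j=1..Ny. flux_y \<psi> \<xi> i j - flux_y \<psi> \<xi> i (j - 1)) else 0)"
    by (intro sum.cong refl) (auto simp: sum_distrib_left)
  finally show ?thesis unfolding sum_flux_y by (simp split: if_splits)
qed

lemma time_step_mass:
  assumes "time_step \<phi> \<phi>' \<xi>'"
  shows "mass \<phi>' = mass \<phi>"
proof -
  from assms obtain \<phi>x \<xi>x \<phi>y \<xi>y where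
    x0: "grid_eq (\<phi>x 0) \<phi>" and
    x: "\<And>q. q \<in> {1..Ny} \<Longrightarrow> substep_x q (\<phi>x (q - 1)) (\<phi>x q) (\<xi>x q)" and
    y0: "grid_eq (\<phi>y 0) (\<phi>x Ny)" and
    y: "\<And>p. p \<in> {1..Nx} \<Longrightarrow> substep_y p (\<phi>y (p - 1)) (\<phi>y p) (\<xi>y p)" and
    fin: "grid_eq \<phi>' (\<phi>y Nx)"
    unfolding time_step_def by blast
  \<comment> \<open>The bound stays inside the induction because substeps are given only for indices
    in \<open>{1..Ny}\<close>.\<close>
  have "q \<le> Ny \<Longrightarrow> mass (\<phi>x q) = mass (\<phi>x 0)" for q
  proof (induction q)
    case (Suc q)
    then show ?case using substep_x_mass[OF x[of "Suc q"]] by simp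
  qed simp
  moreover have "p \<le> Nx \<Longrightarrow> mass (\<phi>y p) = mass (\<phi>y 0)" for p
  proof (induction p)
    case (Suc p)
    then show ?case using substep_y_mass[OF y[of "Suc p"]] by simp
  qed simp
  ultimately show ?thesis
    \<comment> \<open>The chain of equal masses runs \<phi>, \<open>\<phi>x 0\<close>,
      \<open>\<phi>x Ny\<close>, \<open>\<phi>y 0\<close>, \<open>\<phi>y Nx\<close>,
      \<open>\<phi>'\<close>, alternating grid equalities and full sweeps.\<close>
    using mass_cong[OF x0] mass_cong[OF y0] mass_cong[OF fin] by simp
qed

end

theorem theorem5:
  fixes Nx Ny k N :: nat
    and \<Delta>x \<Delta>y \<Delta>t \<epsilon> :: real
    and I :: "real set"
    and F F' :: "real \<Rightarrow> real"
    and \<phi> :: "nat \<Rightarrow> nat \<Rightarrow> nat \<Rightarrow> real"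
    and \<xi> :: "nat \<Rightarrow> real"
  assumes "Nx \<ge> 2" and "Ny \<ge> 2"
    and "\<Delta>x > 0" and "\<Delta>y > 0" and "\<Delta>t > 0" and "\<epsilon> > 0" and "k > 0"
    and "is_interval I"
    and "\<And>x. x \<in> I \<Longrightarrow> (F has_real_derivative F' x) (at x within I)"
    and "\<And>n. n \<le> N \<Longrightarrow> upwind_sav.grid_in Nx Ny I (\<phi> n)"
    and "\<And>n. n < N \<Longrightarrow>
           upwind_sav.time_step Nx Ny \<Delta>x \<Delta>y \<Delta>t \<epsilon> k I F F' (\<phi> n) (\<phi> (Suc n)) (\<xi> (Suc n))"
  shows "\<forall>n<N.
           (\<Sum>i=1..Nx. \<Sum>j=1..Ny. \<phi> (Suc n) i j) = (\<Sum>i=1..Nx. \<Sum>j=1..Ny. \<phi> n i j) \<and>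
           (\<forall>m\<le>n. (\<Sum>i=1..Nx. \<Sum>j=1..Ny. \<phi> n i j) = (\<Sum>i=1..Nx. \<Sum>j=1..Ny. \<phi> m i j))"
proof -
  have step: "(\<Sum>i=1..Nx. \<Sum>j=1..Ny. \<phi> (Suc n) i j) = (\<Sum>i=1..Nx. \<Sum>j=1..Ny. \<phi> n i j)"
    if "n < N" for n
    using upwind_sav.time_step_mass[OF assms(11)[OF that]] unfolding upwind_sav.mass_def .
  have "(\<Sum>i=1..Nx. \<Sum>j=1..Ny. \<phi> n i j) = (\<Sum>i=1..Nx. \<Sum>j=1..Ny. \<phi> m i j)"
    if "m \<le> n" "n < N" for m n
    \<comment> \<open>Induction upwards from \<open>m\<close>. \<open>simplified\<close> turns the
      lower bound \<open>1\<close> into \<open>Suc 0\<close>, the form the simplifier gives the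
      goal.\<close>
    using that by (induction n rule: dec_induct) (simp_all add: step[simplified])
  with step show ?thesis by blast
qed

end
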